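(* Let $S=[A_S;P_S;B_S]$ be a special recursive system and let $p\,\lambda_1,\dots,\lambda_i$ be an elementary prime R-formula which is R-derivable in $S$. Let $n=\max_{j=1}^{i}|\lambda_j|$. Let $k$ be the maximal number of distinct variables occurring in an argument list of any $F\in B_S$, $\alpha$ the maximal number of argument lists occurring in a prime R-formula which is a subformula of any $F\in B_S$, and $\rho$ the maximal number of prime R-formulas occurring in any $F\in B_S$. Then there is an R-derivation $[\Lambda]$ of $p\,\lambda_1,\dots,\lambda_i$ whose number of steps satisfies $$|[\Lambda]|\le |B_S|\,\rho\left(1+\alpha k\left(\alpha\frac{n(n+1)}{2}\,\Gamma(n,k)\right)^{\alpha}\right).$$
   Context: Recursive system $S=[A_S;P_S;B_S]$: finite sets $A_S$ (constant/operation symbols), $P_S$ (predicate symbols), a countably infinite set $X$ of variables, auxiliary symbols $\sim,(,),\,,\,,\to$, and a finite list $B_S$ of R-formulas (basis R-axioms). Lists: $a\in A_S$, $x\in X$, $f(\lambda)$ ($f\in A_S$), concatenations $\lambda\mu$; a sublist of $\lambda$ is $\lambda$ itself, or (recursively, transitively) $\lambda$ inside $f(\lambda)$, or a factor of a concatenation. Elementary = variable-free; $|\lambda|$ = number of symbol occurrences. Prime R-formulas: equations $\sim\lambda,\mu$ and $p\,\lambda_1,\dots,\lambda_m$ ($m\ge0$) for $p\in P_S$, with argument lists $\lambda_j$. R-formulas: prime R-formulas and $\to F\,G$ ($F$ prime, $G$ an R-formula); the last prime R-formula is the R-conclusion, the others the R-premises. R-axioms: $B_S$ and the R-axioms of equality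 ($\sim x,x$; $\to\mathrm{SbF}(\sim\lambda,\mu;x;y)\to\sim x,y\ \sim\lambda,\mu$; $\to\sim x_1,y_1\dots\to\sim x_m,y_m\to p\,x_1,\dots,x_m\ p\,y_1,\dots,y_m$), where $\mathrm{SbF}(F;\lambda;x)=F\frac{\lambda}{x}$ replaces every occurrence of $x$ by $\lambda$. An R-derivation is a list of R-formulas built from the empty list by appending R-axioms, by modus ponens (from steps $F$ and $\to F\,G$ append $G$) and by substitution (from a step $F$ append $F\frac{\lambda}{x}$, $\lambda$ any list); its number of steps is $|[\Lambda]|$. $S$ is special recursive if no equation occurs in $B_S$ and, for every $F\in B_S$, every argument list occurring in an R-premise of $F$ occurs as a sublist of an argument list of the R-conclusion of $F$. For $1\le k\le n$, $\Gamma(n,k)=\max_{j=1}^{k}\binom{n-1}{j-1}$; $\Gamma(n,0)=0$; $\Gamma(n,k)=\Gamma(n,n)$ for $k>n$. *)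

theory Defs
  imports Complex_Main
begin

(* Lists are literal strings over the alphabet consisting of A_S, the variables and the two
   parentheses, so that |l| (number of symbol occurrences) is length l. The countably infinite
   set X of variables is indexed by nat. *)
datatype 'a symbol = Sym 'a | Var nat | LPar | RPar

type_synonym 'a string = "'a symbol list"

inductive is_list :: "'a set \<Rightarrow> 'a string \<Rightarrow> bool" for A :: "'a set" where
  const: "a \<in> A \<Longrightarrow> is_list A [Sym a]"
| var: "is_list A [Var x]"
| app: "f \<in> A \<Longrightarrow> is_list A l \<Longrightarrow> is_list A (Sym f # LPar # l @ [RPar])"
| concat: "is_list A l \<Longrightarrow> is_list A m \<Longrightarrow> is_list A (l @ m)"

inductive sublist_of :: "'a set \<Rightarrow> 'a string \<Rightarrow> 'a string \<Rightarrow> bool" for A :: "'a set" where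
  refl: "is_list A l \<Longrightarrow> sublist_of A l l"
| arg: "f \<in> A \<Longrightarrow> is_list A l \<Longrightarrow> sublist_of A l (Sym f # LPar # l @ [RPar])"
| left: "is_list A l \<Longrightarrow> is_list A m \<Longrightarrow> sublist_of A l (l @ m)"
| right: "is_list A l \<Longrightarrow> is_list A m \<Longrightarrow> sublist_of A m (l @ m)"
| trans: "sublist_of A l m \<Longrightarrow> sublist_of A m r \<Longrightarrow> sublist_of A l r"

definition list_vars :: "'a string \<Rightarrow> nat set" where
  "list_vars l = {x. Var x \<in> set l}"

definition list_subst :: "'a string \<Rightarrow> nat \<Rightarrow> 'a string \<Rightarrow> 'a string" where
  "list_subst t x l = concat (map (\<lambda>s. if s = Var x then t else [s]) l)"

(* Eqn l m is the equation ~ l,m. Predicate symbols have no fixed arity. *)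
datatype ('a, 'p) prime_formula =
    Eqn "'a string" "'a string"
  | Pred 'p "'a string list"

fun args :: "('a, 'p) prime_formula \<Rightarrow> 'a string list" where
  "args (Eqn l m) = [l, m]"
| "args (Pred p ls) = ls"

fun is_equation :: "('a, 'p) prime_formula \<Rightarrow> bool" where
  "is_equation (Eqn l m) \<longleftrightarrow> True"
| "is_equation (Pred p ls) \<longleftrightarrow> False"

fun prime_subst :: "'a string \<Rightarrow> nat \<Rightarrow> ('a, 'p) prime_formula \<Rightarrow> ('a, 'p) prime_formula" where
  "prime_subst t x (Eqn l m) = Eqn (list_subst t x l) (list_subst t x m)"
| "prime_subst t x (Pred p ls) = Pred p (map (list_subst t x) ls)"

datatype ('a, 'p) rformula =
    Prime "('a, 'p) prime_formula"
  | Imp "('a, 'p) prime_formula" "('a, 'p) rformula"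

fun rpremises :: "('a, 'p) rformula \<Rightarrow> ('a, 'p) prime_formula list" where
  "rpremises (Prime P) = []"
| "rpremises (Imp P F) = P # rpremises F"

fun rconclusion :: "('a, 'p) rformula \<Rightarrow> ('a, 'p) prime_formula" where
  "rconclusion (Prime P) = P"
| "rconclusion (Imp P F) = rconclusion F"

(* With multiplicity, in order of occurrence. *)
definition primes_of :: "('a, 'p) rformula \<Rightarrow> ('a, 'p) prime_formula list" where
  "primes_of F = rpremises F @ [rconclusion F]"

fun formula_subst :: "'a string \<Rightarrow> nat \<Rightarrow> ('a, 'p) rformula \<Rightarrow> ('a, 'p) rformula" where
  "formula_subst t x (Prime P) = Prime (prime_subst t x P)"
| "formula_subst t x (Imp P F) = Imp (prime_subst t x P) (formula_subst t x F)"

definition elementary :: "('a, 'p) prime_formula \<Rightarrow> bool" where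
  "elementary P \<longleftrightarrow> (\<forall>l \<in> set (args P). list_vars l = {})"

record ('a, 'p) rsystem =
  op_syms :: "'a set"
  pred_syms :: "'p set"
  basis :: "('a, 'p) rformula list"

fun is_prime_formula :: "('a, 'p) rsystem \<Rightarrow> ('a, 'p) prime_formula \<Rightarrow> bool" where
  "is_prime_formula S (Eqn l m) \<longleftrightarrow> is_list (op_syms S) l \<and> is_list (op_syms S) m"
| "is_prime_formula S (Pred p ls) \<longleftrightarrow>
     p \<in> pred_syms S \<and> (\<forall>l \<in> set ls. is_list (op_syms S) l)"

definition is_rformula :: "('a, 'p) rsystem \<Rightarrow> ('a, 'p) rformula \<Rightarrow> bool" where
  "is_rformula S F \<longleftrightarrow> (\<forall>P \<in> set (primes_of F). is_prime_formula S P)"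

definition recursive_system :: "('a, 'p) rsystem \<Rightarrow> bool" where
  "recursive_system S \<longleftrightarrow> finite (op_syms S) \<and> finite (pred_syms S) \<and>
     (\<forall>F \<in> set (basis S). is_rformula S F)"

definition special_recursive :: "('a, 'p) rsystem \<Rightarrow> bool" where
  "special_recursive S \<longleftrightarrow> recursive_system S \<and>
     (\<forall>F \<in> set (basis S). \<forall>P \<in> set (primes_of F). \<not> is_equation P) \<and>
     (\<forall>F \<in> set (basis S). \<forall>P \<in> set (rpremises F). \<forall>l \<in> set (args P).
        \<exists>m \<in> set (args (rconclusion F)). sublist_of (op_syms S) l m)"

inductive equality_axiom :: "('a, 'p) rsystem \<Rightarrow> ('a, 'p) rformula \<Rightarrow> bool"
  for S :: "('a, 'p) rsystem" where
  eq_refl: "equality_axiom S (Prime (Eqn [Var x] [Var x]))"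
| eq_replace: "is_list (op_syms S) l \<Longrightarrow> is_list (op_syms S) m \<Longrightarrow>
    equality_axiom S (Imp (prime_subst [Var x] y (Eqn l m))
      (Imp (Eqn [Var x] [Var y]) (Prime (Eqn l m))))"
| eq_pred: "p \<in> pred_syms S \<Longrightarrow> length xs = length ys \<Longrightarrow>
    equality_axiom S (foldr Imp (map2 (\<lambda>x y. Eqn [Var x] [Var y]) xs ys)
      (Imp (Pred p (map (\<lambda>x. [Var x]) xs)) (Prime (Pred p (map (\<lambda>y. [Var y]) ys)))))"

definition raxiom :: "('a, 'p) rsystem \<Rightarrow> ('a, 'p) rformula \<Rightarrow> bool" where
  "raxiom S F \<longleftrightarrow> F \<in> set (basis S) \<or> equality_axiom S F"

inductive rderivation :: "('a, 'p) rsystem \<Rightarrow> ('a, 'p) rformula list \<Rightarrow> bool"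
  for S :: "('a, 'p) rsystem" where
  empty: "rderivation S []"
| axiom: "rderivation S D \<Longrightarrow> raxiom S F \<Longrightarrow> rderivation S (D @ [F])"
| modus_ponens: "rderivation S D \<Longrightarrow> Prime P \<in> set D \<Longrightarrow> Imp P G \<in> set D \<Longrightarrow>
    rderivation S (D @ [G])"
| subst: "rderivation S D \<Longrightarrow> F \<in> set D \<Longrightarrow> is_list (op_syms S) l \<Longrightarrow>
    rderivation S (D @ [formula_subst l x F])"

definition rderivation_of ::
    "('a, 'p) rsystem \<Rightarrow> ('a, 'p) rformula list \<Rightarrow> ('a, 'p) rformula \<Rightarrow> bool" where
  "rderivation_of S D F \<longleftrightarrow> rderivation S D \<and> D \<noteq> [] \<and> last D = F"

definition rderivable :: "('a, 'p) rsystem \<Rightarrow> ('a, 'p) rformula \<Rightarrow> bool" where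
  "rderivable S F \<longleftrightarrow> (\<exists>D. rderivation_of S D F)"

definition Gamma_max :: "nat \<Rightarrow> nat \<Rightarrow> nat" where
  "Gamma_max n k = (if min n k = 0 then 0
     else Max ((\<lambda>j. (n - 1) choose (j - 1)) ` {1..min n k}))"

(* In the following maxima, inserting 0 only fixes the value of an empty maximum. *)

definition max_length :: "'a string list \<Rightarrow> nat" where
  "max_length ls = Max (insert 0 (length ` set ls))"

definition max_vars :: "('a, 'p) rsystem \<Rightarrow> nat" where
  "max_vars S = Max (insert 0 {card (list_vars l) | F P l.
     F \<in> set (basis S) \<and> P \<in> set (primes_of F) \<and> l \<in> set (args P)})"

definition max_args :: "('a, 'p) rsystem \<Rightarrow> nat" where
  "max_args S = Max (insert 0 {length (args P) | F P.
     F \<in> set (basis S) \<and> P \<in> set (primes_of F)})"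

definition max_primes :: "('a, 'p) rsystem \<Rightarrow> nat" where
  "max_primes S = Max (insert 0 {length (primes_of F) | F. F \<in> set (basis S)})"

end

(* Interpret equations as identity of strings and let the true predicate formulas be the least
   set closed under the instances of the basis axioms. All R-axioms are valid there because B_S
   contains no equations, so derivable predicate formulas follow by using instances of basis axioms
   alone. In a special recursive system the premises of an instance have argument lists that are
   sublists of those of its conclusion; hence only instances whose conclusion has all its argument
   lists among the at most alpha n (n + 1) / 2 nonempty substrings of the given lists are needed,
   and each of them once. Solving m sigma = w for the k' variables of m amounts to choosing a
   composition of |w| into k' parts, which accounts for Gamma. An instance costs at most alpha k
   substitutions and rho - 1 modus ponens steps, and
   alpha k + rho - 1 <= rho alpha k as soon as alpha k >= 1. *)

theory Submission
  imports Defs "HOL-Library.Sublist"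
begin

section \<open>Simultaneous substitution\<close>

text \<open>Instances of axioms are described by one simultaneous assignment, whereas the
  substitution rule replaces one variable at a time. Values may be empty, which later marks the
  variables outside a formula.\<close>

definition sub :: "(nat \<Rightarrow> 'a string) \<Rightarrow> 'a string \<Rightarrow> 'a string" where
  "sub \<sigma> l = concat (map (\<lambda>s. case s of Var x \<Rightarrow> \<sigma> x | _ \<Rightarrow> [s]) l)"

fun psub :: "(nat \<Rightarrow> 'a string) \<Rightarrow> ('a, 'p) prime_formula \<Rightarrow> ('a, 'p) prime_formula" where
  "psub \<sigma> (Eqn l m) = Eqn (sub \<sigma> l) (sub \<sigma> m)"
| "psub \<sigma> (Pred p ls) = Pred p (map (sub \<sigma>) ls)"

fun fsub :: "(nat \<Rightarrow> 'a string) \<Rightarrow> ('a, 'p) rformula \<Rightarrow> ('a, 'p) rformula" where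
  "fsub \<sigma> (Prime P) = Prime (psub \<sigma> P)"
| "fsub \<sigma> (Imp P F) = Imp (psub \<sigma> P) (fsub \<sigma> F)"

definition prime_vars :: "('a, 'p) prime_formula \<Rightarrow> nat set" where
  "prime_vars P = (\<Union>l\<in>set (args P). list_vars l)"

definition formula_vars :: "('a, 'p) rformula \<Rightarrow> nat set" where
  "formula_vars F = (\<Union>P\<in>set (primes_of F). prime_vars P)"

lemma sub_Nil [simp]: "sub \<sigma> [] = []"
  by (simp add: sub_def)

lemma sub_append [simp]: "sub \<sigma> (l @ m) = sub \<sigma> l @ sub \<sigma> m"
  by (simp add: sub_def)

lemma sub_Cons [simp]:
  "sub \<sigma> (Var x # l) = \<sigma> x @ sub \<sigma> l"
  "sub \<sigma> (Sym a # l) = Sym a # sub \<sigma> l"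
  "sub \<sigma> (LPar # l) = LPar # sub \<sigma> l"
  "sub \<sigma> (RPar # l) = RPar # sub \<sigma> l"
  by (simp_all add: sub_def)

lemma list_vars_simps [simp]:
  "list_vars [] = {}"
  "list_vars (Var x # l) = insert x (list_vars l)"
  "list_vars (Sym a # l) = list_vars l"
  "list_vars (LPar # l) = list_vars l"
  "list_vars (RPar # l) = list_vars l"
  "list_vars (l @ m) = list_vars l \<union> list_vars m"
  by (auto simp: list_vars_def)

lemma string_induct [case_names Nil Sym Var LPar RPar]:
  assumes "P []" "\<And>a l. P l \<Longrightarrow> P (Sym a # l)" "\<And>x l. P l \<Longrightarrow> P (Var x # l)"
    "\<And>l. P l \<Longrightarrow> P (LPar # l)" "\<And>l. P l \<Longrightarrow> P (RPar # l)"
  shows "P (l :: 'a string)"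
proof (induction l)
  case (Cons s l)
  then show ?case using assms by (cases s) auto
qed (rule assms(1))

lemma finite_list_vars [simp]: "finite (list_vars l)"
  by (induction l rule: string_induct) auto

lemma finite_formula_vars [simp]: "finite (formula_vars F)"
  by (auto simp: formula_vars_def prime_vars_def)

lemma sub_cong: "(\<And>x. x \<in> list_vars l \<Longrightarrow> \<sigma> x = \<tau> x) \<Longrightarrow> sub \<sigma> l = sub \<tau> l"
  by (induction l rule: string_induct) auto

lemma psub_cong: "(\<And>x. x \<in> prime_vars P \<Longrightarrow> \<sigma> x = \<tau> x) \<Longrightarrow> psub \<sigma> P = psub \<tau> P"
  by (cases P) (auto simp: prime_vars_def intro!: sub_cong)

lemma primes_of_simps [simp]:
  "primes_of (Prime P) = [P]"
  "primes_of (Imp P F) = P # primes_of F"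
  by (simp_all add: primes_of_def)

lemma formula_vars_simps [simp]:
  "formula_vars (Prime P) = prime_vars P"
  "formula_vars (Imp P F) = prime_vars P \<union> formula_vars F"
  by (auto simp: formula_vars_def)

lemma fsub_cong: "(\<And>x. x \<in> formula_vars F \<Longrightarrow> \<sigma> x = \<tau> x) \<Longrightarrow> fsub \<sigma> F = fsub \<tau> F"
  by (induction F) (auto intro!: psub_cong)

lemma sub_Var [simp]: "sub (\<lambda>x. [Var x]) l = l"
  by (induction l rule: string_induct) auto

lemma psub_Var [simp]: "psub (\<lambda>x. [Var x]) P = P"
  by (cases P) (auto intro: map_idI)

lemma fsub_Var [simp]: "fsub (\<lambda>x. [Var x]) F = F"
  by (induction F) auto

lemma rpremises_fsub [simp]: "rpremises (fsub \<sigma> F) = map (psub \<sigma>) (rpremises F)"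
  by (induction F) auto

lemma rconclusion_fsub [simp]: "rconclusion (fsub \<sigma> F) = psub \<sigma> (rconclusion F)"
  by (induction F) auto

lemma args_psub [simp]: "args (psub \<sigma> P) = map (sub \<sigma>) (args P)"
  by (cases P) auto

section \<open>Single substitutions composed with simultaneous ones\<close>

lemma list_subst_simps [simp]:
  "list_subst t x [] = []"
  "list_subst t x (s # l) = (if s = Var x then t else [s]) @ list_subst t x l"
  "list_subst t x (l @ m) = list_subst t x l @ list_subst t x m"
  by (auto simp: list_subst_def)

lemma list_subst_ground: "x \<notin> list_vars l \<Longrightarrow> list_subst t x l = l"
  by (induction l rule: string_induct) auto

text \<open>This order of composition turns a single substitution into a change of the assignment,
  which is what the soundness proof needs.\<close>

lemma sub_list_subst: "sub \<sigma> (list_subst t x l) = sub (\<sigma>(x := sub \<sigma> t)) l"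
  by (induction l rule: string_induct) auto

lemma psub_prime_subst: "psub \<sigma> (prime_subst t x P) = psub (\<sigma>(x := sub \<sigma> t)) P"
  by (cases P) (auto simp: sub_list_subst)

lemma fsub_formula_subst: "fsub \<sigma> (formula_subst t x F) = fsub (\<sigma>(x := sub \<sigma> t)) F"
  by (induction F) (auto simp: psub_prime_subst simp del: fun_upd_apply)

text \<open>The opposite order, a single substitution into an instance, serves to build a
  simultaneous assignment out of derivation steps.\<close>

lemma list_subst_sub: "list_subst t x (sub \<sigma> l) = sub (\<lambda>y. list_subst t x (\<sigma> y)) l"
  by (induction l rule: string_induct) auto

lemma prime_subst_psub: "prime_subst t x (psub \<sigma> P) = psub (\<lambda>y. list_subst t x (\<sigma> y)) P"
  by (cases P) (auto simp: list_subst_sub)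

lemma formula_subst_fsub: "formula_subst t x (fsub \<sigma> F) = fsub (\<lambda>y. list_subst t x (\<sigma> y)) F"
  by (induction F) (auto simp: prime_subst_psub)

lemma list_vars_sub: "list_vars (sub \<sigma> l) = (\<Union>x\<in>list_vars l. list_vars (\<sigma> x))"
  by (induction l rule: string_induct) auto

section \<open>Lists and their sublists as strings\<close>

lemma is_list_not_Nil: "is_list A l \<Longrightarrow> l \<noteq> []"
  by (induction rule: is_list.induct) auto

lemma is_list_sub: "is_list A l \<Longrightarrow> (\<And>x. is_list A (\<sigma> x)) \<Longrightarrow> is_list A (sub \<sigma> l)"
  by (induction rule: is_list.induct) (auto intro: is_list.intros)

text \<open>Each rule of \<open>sublist_of\<close> yields a contiguous block of the larger string,
  and contiguous blocks are easy to count.\<close>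

lemma sublist_of_imp_sublist: "sublist_of A l m \<Longrightarrow> sublist l m"
proof (induction rule: sublist_of.induct)
  case (arg f l)
  have "Sym f # LPar # l @ [RPar] = [Sym f, LPar] @ l @ [RPar]" by simp
  then show ?case unfolding sublist_def by blast
next
  case (trans l m r)
  then show ?case using sublist_order.order.trans by blast
qed auto

lemma sublist_sub: "sublist l m \<Longrightarrow> sublist (sub \<sigma> l) (sub \<sigma> m)"
  unfolding sublist_def by (metis sub_append)

section \<open>Soundness for the least model\<close>

text \<open>Formulas with variables are kept in the model: without operation symbols
  there are no elementary lists to interpret the variables by.\<close>

inductive forced :: "('a, 'p) rsystem \<Rightarrow> ('a, 'p) prime_formula \<Rightarrow> bool"
  for S :: "('a, 'p) rsystem" where
  step: "F \<in> set (basis S) \<Longrightarrow> (\<And>x. is_list (op_syms S) (\<sigma> x)) \<Longrightarrow>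
    (\<And>P. P \<in> set (rpremises F) \<Longrightarrow> forced S (psub \<sigma> P)) \<Longrightarrow>
    forced S (psub \<sigma> (rconclusion F))"

fun holds :: "('a, 'p) rsystem \<Rightarrow> ('a, 'p) prime_formula \<Rightarrow> bool" where
  "holds S (Eqn l m) \<longleftrightarrow> l = m"
| "holds S (Pred p ls) \<longleftrightarrow> forced S (Pred p ls)"

definition valid :: "('a, 'p) rsystem \<Rightarrow> ('a, 'p) rformula \<Rightarrow> bool" where
  "valid S F \<longleftrightarrow> (\<forall>\<sigma>. (\<forall>x. is_list (op_syms S) (\<sigma> x)) \<longrightarrow>
     (\<forall>P\<in>set (rpremises (fsub \<sigma> F)). holds S P) \<longrightarrow> holds S (rconclusion (fsub \<sigma> F)))"

lemma holds_eq_forced: "\<not> is_equation P \<Longrightarrow> holds S (psub \<sigma> P) \<longleftrightarrow> forced S (psub \<sigma> P)"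
  by (cases P) auto

text \<open>Without equations, \<open>holds\<close> agrees with \<open>forced\<close> on premises
  and conclusion, so validity is the closure rule \<open>forced.step\<close>.\<close>

lemma valid_basis:
  assumes "F \<in> set (basis S)" "\<And>P. P \<in> set (primes_of F) \<Longrightarrow> \<not> is_equation P"
  shows "valid S F"
  unfolding valid_def
  using assms by (auto simp: primes_of_def holds_eq_forced intro!: forced.step)

lemma rpremises_foldr_Imp [simp]: "rpremises (foldr Imp Ps F) = Ps @ rpremises F"
  by (induction Ps) auto

lemma rconclusion_foldr_Imp [simp]: "rconclusion (foldr Imp Ps F) = rconclusion F"
  by (induction Ps) auto

lemma valid_equality_axiom:
  fixes S :: "('a, 'p) rsystem"
  assumes "equality_axiom S F"
  shows "valid S F"
  using assms
proof cases
  case eq_refl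
  then show ?thesis by (simp add: valid_def)
next
  case (eq_replace l m x y)
  \<comment> \<open>The second premise gives \<open>\<sigma> x = \<sigma> y\<close>, so overwriting
    the value at \<open>y\<close> by \<open>\<sigma> x\<close> changes nothing and the first premise
    is the conclusion.\<close>
  then show ?thesis by (auto simp: valid_def sub_list_subst fun_upd_idem)
next
  case (eq_pred p xs ys)
  \<comment> \<open>The equality premises identify the two argument lists, so the conclusion is
    literally the last premise.\<close>
  have "map \<sigma> xs = map \<sigma> ys"
    if "\<forall>P\<in>set (map2 (\<lambda>x y. Eqn [Var x] [Var y] :: ('a, 'p) prime_formula) xs ys). holds S (psub \<sigma> P)"
    for \<sigma> :: "nat \<Rightarrow> 'a string"
    using that eq_pred(3) by (induction xs ys rule: list_induct2') auto
  then show ?thesis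
    by (auto simp: valid_def eq_pred(1) o_def)
qed

text \<open>The updated assignment \<open>\<sigma>(x := sub \<sigma> t)\<close> again takes only
  lists as values.\<close>

lemma valid_formula_subst:
  assumes "valid S F" "is_list (op_syms S) t"
  shows "valid S (formula_subst t x F)"
  using assms unfolding valid_def fsub_formula_subst by (simp add: is_list_sub)

lemma valid_modus_ponens: "valid S (Prime P) \<Longrightarrow> valid S (Imp P G) \<Longrightarrow> valid S G"
  by (auto simp: valid_def)

lemma derivation_valid:
  assumes "\<And>F P. F \<in> set (basis S) \<Longrightarrow> P \<in> set (primes_of F) \<Longrightarrow> \<not> is_equation P"
    and "rderivation S D"
  shows "\<forall>F\<in>set D. valid S F"
  using assms(2)
proof (induction rule: rderivation.induct)
  case (axiom D F)
  then have "valid S F"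
    using assms(1) valid_basis[of F S] valid_equality_axiom[of S F] by (auto simp: raxiom_def)
  with axiom.IH show ?case by simp
next
  case (modus_ponens D P G)
  then have "valid S G" using valid_modus_ponens[of S P G] by blast
  with modus_ponens.IH show ?case by simp
next
  case (subst D F l x)
  then have "valid S (formula_subst l x F)" using valid_formula_subst by blast
  with subst.IH show ?case by simp
qed simp

lemma rderivable_Pred_forced:
  assumes "special_recursive S" "rderivable S (Prime (Pred p ls))"
  shows "forced S (Pred p ls)"
proof -
  obtain D where D: "rderivation S D" "D \<noteq> []" "last D = Prime (Pred p ls)"
    using assms(2) by (auto simp: rderivable_def rderivation_of_def)
  then have "valid S (Prime (Pred p ls))"
    using derivation_valid[of S D] assms(1) last_in_set[of D]
    by (auto simp: special_recursive_def)
  \<comment> \<open>Mapping every variable to itself is an assignment by lists and leaves the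
    formula unchanged.\<close>
  then have "holds S (rconclusion (fsub (\<lambda>x. [Var x]) (Prime (Pred p ls))))"
    unfolding valid_def by (elim allE[of _ "\<lambda>x. [Var x]"]) (simp add: is_list.var)
  then show ?thesis by simp
qed

section \<open>Extending derivations\<close>

text \<open>The variables are replaced one after another. Since the values are ground, later
  substitutions leave the values inserted earlier intact, so the steps add up to the simultaneous
  substitution.\<close>

lemma rderivation_append_subst:
  assumes "rderivation S D" "F \<in> set D" "finite V"
    and "\<And>x. x \<in> V \<Longrightarrow> is_list (op_syms S) (\<sigma> x) \<and> list_vars (\<sigma> x) = {}"
  shows "\<exists>E. rderivation S (D @ E) \<and> length E \<le> card V \<and>
    fsub (\<lambda>x. if x \<in> V then \<sigma> x else [Var x]) F \<in> set (D @ E)"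
  using assms(3,4)
proof (induction V rule: finite_induct)
  case empty
  show ?case using assms(1,2) by (intro exI[of _ "[]"]) simp
next
  case (insert x V)
  let ?\<tau> = "\<lambda>V y. if y \<in> V then \<sigma> y else [Var y]"
  obtain E where E: "rderivation S (D @ E)" "length E \<le> card V" "fsub (?\<tau> V) F \<in> set (D @ E)"
    using insert by auto
  have "(\<lambda>y. list_subst (\<sigma> x) x (?\<tau> V y)) = ?\<tau> (insert x V)"
    using insert by (auto simp: list_subst_ground)
  then have eq: "formula_subst (\<sigma> x) x (fsub (?\<tau> V) F) = fsub (?\<tau> (insert x V)) F"
    by (simp only: formula_subst_fsub)
  have "rderivation S ((D @ E) @ [fsub (?\<tau> (insert x V)) F])"
    unfolding eq[symmetric] using E insert.prems by (intro rderivation.subst) auto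
  then show ?case
    using E(2) insert by (intro exI[of _ "E @ [fsub (?\<tau> (insert x V)) F]"]) simp
qed

text \<open>The premises are detached from left to right, one step for each.\<close>

lemma rderivation_append_modus_ponens:
  assumes "rderivation S D" "F \<in> set D" "\<And>P. P \<in> set (rpremises F) \<Longrightarrow> Prime P \<in> set D"
  shows "\<exists>E. rderivation S (D @ E) \<and> length E \<le> length (rpremises F) \<and>
    Prime (rconclusion F) \<in> set (D @ E)"
  using assms
proof (induction F arbitrary: D)
  case (Prime P)
  then show ?case by (intro exI[of _ "[]"]) simp
next
  case (Imp P F)
  have "rderivation S (D @ [F])"
    using Imp.prems by (intro rderivation.modus_ponens) auto
  with Imp.IH[of "D @ [F]"] Imp.prems obtain E where
    "rderivation S ((D @ [F]) @ E)" "length E \<le> length (rpremises F)"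
    "Prime (rconclusion F) \<in> set ((D @ [F]) @ E)"
    by auto
  then show ?case by (intro exI[of _ "F # E"]) simp
qed

text \<open>The cost is one step per variable and one per premise; the axiom itself is not charged,
  as it already occurs in \<open>D\<close>.\<close>

lemma rderivation_append_instance:
  assumes "rderivation S D" "F \<in> set D"
    and \<sigma>: "\<And>x. x \<in> formula_vars F \<Longrightarrow> is_list (op_syms S) (\<sigma> x) \<and> list_vars (\<sigma> x) = {}"
    and prems: "\<And>P. P \<in> set (rpremises F) \<Longrightarrow> Prime (psub \<sigma> P) \<in> set D"
  shows "\<exists>E. rderivation S (D @ E) \<and> length E \<le> card (formula_vars F) + length (rpremises F) \<and>
    Prime (psub \<sigma> (rconclusion F)) \<in> set (D @ E)"
proof -
  have eq: "fsub (\<lambda>x. if x \<in> formula_vars F then \<sigma> x else [Var x]) F = fsub \<sigma> F"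
    by (rule fsub_cong) simp
  obtain E1 where E1: "rderivation S (D @ E1)" "length E1 \<le> card (formula_vars F)"
    "fsub \<sigma> F \<in> set (D @ E1)"
    using rderivation_append_subst[OF assms(1,2) finite_formula_vars, of F \<sigma>] \<sigma> unfolding eq by blast
  obtain E2 where E2: "rderivation S ((D @ E1) @ E2)"
    "length E2 \<le> length (rpremises (fsub \<sigma> F))"
    "Prime (rconclusion (fsub \<sigma> F)) \<in> set ((D @ E1) @ E2)"
    using rderivation_append_modus_ponens[OF E1(1,3)] prems by auto
  show ?thesis
    using E1 E2 by (intro exI[of _ "E1 @ E2"]) simp
qed

section \<open>Prefixes of derivations\<close>

lemma rderivation_butlast: "rderivation S D \<Longrightarrow> rderivation S (butlast D)"
  by (induction rule: rderivation.induct) (auto intro: rderivation.empty)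

lemma rderivation_appendD: "rderivation S (D @ E) \<Longrightarrow> rderivation S D"
proof (induction E rule: rev_induct)
  case (snoc s E)
  then show ?case using rderivation_butlast[OF snoc.prems] by (simp add: butlast_append)
qed simp

text \<open>The construction only ensures that the target occurs somewhere; cutting behind an
  occurrence makes it the last step.\<close>

lemma rderivation_of_prefix:
  assumes "rderivation S D" "F \<in> set D"
  shows "\<exists>E. rderivation_of S E F \<and> length E \<le> length D"
proof -
  obtain D1 D2 where D: "D = (D1 @ [F]) @ D2"
    using split_list[OF assms(2)] by auto
  with assms(1) have "rderivation S (D1 @ [F])" using rderivation_appendD by blast
  then show ?thesis unfolding D rderivation_of_def by (intro exI[of _ "D1 @ [F]"]) simp
qed

lemma rderivation_basis: "set Fs \<subseteq> set (basis S) \<Longrightarrow> rderivation S Fs"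
  by (induction Fs rule: rev_induct) (auto intro: rderivation.intros simp: raxiom_def)

section \<open>Using every instance of a basis axiom once\<close>

definition substrings :: "'a string list \<Rightarrow> 'a string set" where
  "substrings ls = {w. w \<noteq> [] \<and> (\<exists>l\<in>set ls. sublist w l)}"

text \<open>Assignments vanish outside the variables of the formula, so that different assignments
  give different instances.\<close>

definition instances :: "('a, 'p) rsystem \<Rightarrow> 'a string set \<Rightarrow> (('a, 'p) rformula \<times> (nat \<Rightarrow> 'a string)) set" where
  "instances S W = {(F, \<sigma>). F \<in> set (basis S) \<and> (\<forall>x. x \<notin> formula_vars F \<longrightarrow> \<sigma> x = []) \<and>
     (\<forall>x\<in>formula_vars F. is_list (op_syms S) (\<sigma> x)) \<and>
     (\<forall>m\<in>set (args (rconclusion F)). sub \<sigma> m \<in> W)}"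

text \<open>\<open>U\<close> records the instances paid for so far. The basis axioms are charged
  once, each recorded instance at most \<open>c\<close> steps; its conclusion is present, so it need
  never be repeated.\<close>

definition economical ::
    "('a, 'p) rsystem \<Rightarrow> 'a string set \<Rightarrow> nat \<Rightarrow> ('a, 'p) rformula list \<Rightarrow> bool" where
  "economical S W c D \<longleftrightarrow> rderivation S D \<and> set (basis S) \<subseteq> set D \<and>
     (\<exists>U\<subseteq>instances S W. (\<forall>F \<sigma>. (F, \<sigma>) \<in> U \<longrightarrow> Prime (psub \<sigma> (rconclusion F)) \<in> set D) \<and>
        length D \<le> length (basis S) + c * card U)"

text \<open>In a special recursive system each premise argument lies inside a conclusion argument,
  so premises bring no new variables.\<close>

lemma formula_vars_conclusion:
  assumes "special_recursive S" "F \<in> set (basis S)"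
  shows "formula_vars F = prime_vars (rconclusion F)"
proof -
  have "prime_vars P \<subseteq> prime_vars (rconclusion F)" if "P \<in> set (rpremises F)" for P
  proof
    fix x assume "x \<in> prime_vars P"
    then obtain l where l: "l \<in> set (args P)" "x \<in> list_vars l" by (auto simp: prime_vars_def)
    with assms that obtain m where "m \<in> set (args (rconclusion F))" "sublist_of (op_syms S) l m"
      unfolding special_recursive_def by blast
    moreover from this(2) have "set l \<subseteq> set m"
      by (intro set_mono_sublist sublist_of_imp_sublist)
    ultimately show "x \<in> prime_vars (rconclusion F)"
      using l(2) by (auto simp: prime_vars_def list_vars_def)
  qed
  then show ?thesis by (auto simp: formula_vars_def primes_of_def)
qed

text \<open>Passing from a conclusion to its premises never leaves the finite set
  \<open>substrings ls\<close>. Nonempty values are required because that set excludes the empty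
  string.\<close>

lemma premise_args_substrings:
  assumes "special_recursive S" "F \<in> set (basis S)" "P \<in> set (rpremises F)"
    and ne: "\<And>x. \<sigma> x \<noteq> []"
    and "set (args (psub \<sigma> (rconclusion F))) \<subseteq> substrings ls"
  shows "set (args (psub \<sigma> P)) \<subseteq> substrings ls"
proof
  fix w assume "w \<in> set (args (psub \<sigma> P))"
  then obtain l where l: "l \<in> set (args P)" "w = sub \<sigma> l" by auto
  obtain m where m: "m \<in> set (args (rconclusion F))" "sublist_of (op_syms S) l m"
    using assms(1-3) l(1) unfolding special_recursive_def by blast
  have "is_prime_formula S P"
    using assms(1-3) by (auto simp: special_recursive_def recursive_system_def is_rformula_def primes_of_def)
  with l(1) have "l \<noteq> []" by (cases P) (auto dest: is_list_not_Nil)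
  then have "w \<noteq> []"
    unfolding l(2) using ne by (cases l) (auto simp: sub_def split: symbol.splits)
  moreover have "sub \<sigma> m \<in> substrings ls" using assms(5) m(1) by auto
  moreover have "sublist w (sub \<sigma> m)"
    unfolding l(2) by (intro sublist_sub sublist_of_imp_sublist[OF m(2)])
  ultimately show "w \<in> substrings ls"
    unfolding substrings_def using sublist_order.order.trans by blast
qed

lemma substrings_ground:
  assumes "\<And>l. l \<in> set ls \<Longrightarrow> list_vars l = {}" "w \<in> substrings ls"
  shows "list_vars w = {}"
proof -
  obtain l where "l \<in> set ls" "set w \<subseteq> set l"
    using assms(2) set_mono_sublist unfolding substrings_def by blast
  with assms(1) show ?thesis by (fastforce simp: list_vars_def)
qed

text \<open>An instance already in \<open>U\<close> costs nothing; a new one enlarges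
  \<open>U\<close> by one element and pays for at most \<open>c\<close> steps.\<close>

lemma economical_extend_instance:
  assumes "special_recursive S"
    and ground: "\<And>l. l \<in> set ls \<Longrightarrow> list_vars l = {}"
    and fin: "finite (instances S (substrings ls))"
    and c: "\<And>F \<sigma>. (F, \<sigma>) \<in> instances S (substrings ls) \<Longrightarrow>
      card (formula_vars F) + length (rpremises F) \<le> c"
    and i: "(F, \<sigma>) \<in> instances S (substrings ls)"
    and D: "economical S (substrings ls) c D"
    and prems: "\<And>P. P \<in> set (rpremises F) \<Longrightarrow> Prime (psub \<sigma> P) \<in> set D"
  shows "\<exists>E. economical S (substrings ls) c (D @ E) \<and>
    Prime (psub \<sigma> (rconclusion F)) \<in> set (D @ E)"
proof -
  obtain U where U: "U \<subseteq> instances S (substrings ls)"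
    "\<And>F \<sigma>. (F, \<sigma>) \<in> U \<Longrightarrow> Prime (psub \<sigma> (rconclusion F)) \<in> set D"
    "length D \<le> length (basis S) + c * card U"
    using D unfolding economical_def by blast
  show ?thesis
  proof (cases "(F, \<sigma>) \<in> U")
    case True
    then show ?thesis using D U(2) by (intro exI[of _ "[]"]) simp
  next
    case False
    have F: "F \<in> set (basis S)" using i by (simp add: instances_def)
    \<comment> \<open>The value \<open>\<sigma> x\<close> is part of some
      \<open>sub \<sigma> m\<close> with \<open>m\<close> a conclusion argument, and that string is
      ground.\<close>
    have "list_vars (\<sigma> x) = {}" if x: "x \<in> formula_vars F" for x
    proof -
      obtain m where "m \<in> set (args (rconclusion F))" "x \<in> list_vars m"
        using x formula_vars_conclusion[OF assms(1) F] by (auto simp: prime_vars_def)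
      moreover from this have "list_vars (sub \<sigma> m) = {}"
        using i substrings_ground[OF ground] by (auto simp: instances_def)
      ultimately show ?thesis by (auto simp: list_vars_sub)
    qed
    then have "\<And>x. x \<in> formula_vars F \<Longrightarrow> is_list (op_syms S) (\<sigma> x) \<and> list_vars (\<sigma> x) = {}"
      using i by (auto simp: instances_def)
    from rderivation_append_instance[OF _ _ this prems] D F obtain E where
      E: "rderivation S (D @ E)" "length E \<le> card (formula_vars F) + length (rpremises F)"
        "Prime (psub \<sigma> (rconclusion F)) \<in> set (D @ E)"
      unfolding economical_def by blast
    have "finite U" using U(1) fin by (rule finite_subset)
    with False have "card (insert (F, \<sigma>) U) = Suc (card U)" by simp
    with U(3) E(2) c[OF i] have "length (D @ E) \<le> length (basis S) + c * card (insert (F, \<sigma>) U)"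
      by simp
    moreover have "set (basis S) \<subseteq> set (D @ E)" using D by (auto simp: economical_def)
    moreover have "\<forall>G \<tau>. (G, \<tau>) \<in> insert (F, \<sigma>) U \<longrightarrow> Prime (psub \<tau> (rconclusion G)) \<in> set (D @ E)"
      using U(2) E(3) by auto
    ultimately have "economical S (substrings ls) c (D @ E)"
      unfolding economical_def using E(1) U(1) i by (intro conjI exI[of _ "insert (F, \<sigma>) U"]) auto
    with E(3) show ?thesis by blast
  qed
qed

text \<open>Induction along the generation of the least model. \<open>D\<close> is arbitrary because
  each premise is derived on top of the derivation left by the previous premises, whose recorded
  instances are shared.\<close>

lemma economical_extend_forced:
  assumes "special_recursive S"
    and ground: "\<And>l. l \<in> set ls \<Longrightarrow> list_vars l = {}"
    and fin: "finite (instances S (substrings ls))"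
    and c: "\<And>F \<sigma>. (F, \<sigma>) \<in> instances S (substrings ls) \<Longrightarrow>
      card (formula_vars F) + length (rpremises F) \<le> c"
    and "forced S P" "set (args P) \<subseteq> substrings ls" "economical S (substrings ls) c D"
  shows "\<exists>E. economical S (substrings ls) c (D @ E) \<and> Prime P \<in> set (D @ E)"
  using assms(5-7)
proof (induction arbitrary: D rule: forced.induct)
  case (step F \<sigma>)
  have ne: "\<sigma> x \<noteq> []" for x using step.hyps(2) is_list_not_Nil by blast
  have "\<exists>E. economical S (substrings ls) c (D @ E) \<and> (\<forall>P\<in>set Ps. Prime (psub \<sigma> P) \<in> set (D @ E))"
    if "set Ps \<subseteq> set (rpremises F)" for Ps
    using that
  proof (induction Ps)
    case Nil
    then show ?case using step.prems by (intro exI[of _ "[]"]) simp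
  next
    case (Cons P Ps)
    then obtain E where E: "economical S (substrings ls) c (D @ E)"
      "\<forall>P\<in>set Ps. Prime (psub \<sigma> P) \<in> set (D @ E)"
      by auto
    have P: "P \<in> set (rpremises F)" using Cons.prems by simp
    obtain E' where "economical S (substrings ls) c ((D @ E) @ E')"
      "Prime (psub \<sigma> P) \<in> set ((D @ E) @ E')"
      using step.IH[OF P premise_args_substrings[OF assms(1) step.hyps(1) P ne step.prems(1)] E(1)]
      by blast
    with E(2) show ?case by (intro exI[of _ "E @ E'"]) auto
  qed
  from this[OF subset_refl] obtain E where E: "economical S (substrings ls) c (D @ E)"
    "\<And>P. P \<in> set (rpremises F) \<Longrightarrow> Prime (psub \<sigma> P) \<in> set (D @ E)"
    by blast
  \<comment> \<open>Cutting \<open>\<sigma>\<close> off outside the variables of \<open>F\<close>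
    gives the normal form demanded by \<open>instances\<close>.\<close>
  define \<tau> where "\<tau> x = (if x \<in> formula_vars F then \<sigma> x else [])" for x
  have eq: "psub \<tau> P = psub \<sigma> P" if "P \<in> set (primes_of F)" for P
    using that by (intro psub_cong) (auto simp: \<tau>_def formula_vars_def)
  have concl: "psub \<tau> (rconclusion F) = psub \<sigma> (rconclusion F)"
    by (rule eq) (simp add: primes_of_def)
  have "set (args (psub \<tau> (rconclusion F))) \<subseteq> substrings ls"
    unfolding concl by (rule step.prems)
  then have "(F, \<tau>) \<in> instances S (substrings ls)"
    using step.hyps(1,2) by (auto simp: instances_def \<tau>_def[of x for x])
  moreover have "Prime (psub \<tau> P) \<in> set (D @ E)" if "P \<in> set (rpremises F)" for P
    using E(2)[OF that] eq[of P] that by (simp add: primes_of_def)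
  ultimately have "\<exists>E'. economical S (substrings ls) c ((D @ E) @ E') \<and>
      Prime (psub \<tau> (rconclusion F)) \<in> set ((D @ E) @ E')"
    by (intro economical_extend_instance[OF assms(1) ground fin c _ E(1)])
  then obtain E' where "economical S (substrings ls) c ((D @ E) @ E')"
    "Prime (psub \<tau> (rconclusion F)) \<in> set ((D @ E) @ E')"
    by blast
  then show ?case unfolding concl by (intro exI[of _ "E @ E'"]) simp
qed

text \<open>The construction starts from the bare list of basis axioms with no instance recorded; at
  the end \<open>U\<close> is at most the whole of \<open>instances\<close>, and the cut behind the
  target only shortens the derivation.\<close>

lemma derivation_bound_instances:
  assumes "special_recursive S"
    and ground: "\<And>l. l \<in> set ls \<Longrightarrow> list_vars l = {}" and ne: "[] \<notin> set ls"
    and fin: "finite (instances S (substrings ls))"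
    and c: "\<And>F \<sigma>. (F, \<sigma>) \<in> instances S (substrings ls) \<Longrightarrow>
      card (formula_vars F) + length (rpremises F) \<le> c"
    and "forced S (Pred p ls)"
  shows "\<exists>D. rderivation_of S D (Prime (Pred p ls)) \<and>
    length D \<le> length (basis S) + c * card (instances S (substrings ls))"
proof -
  have "economical S (substrings ls) c (basis S)"
    unfolding economical_def by (auto simp: rderivation_basis intro: exI[of _ "{}"])
  moreover have "set (args (Pred p ls :: ('a, 'b) prime_formula)) \<subseteq> substrings ls"
    using ne by (auto simp: substrings_def)
  ultimately have "\<exists>E. economical S (substrings ls) c (basis S @ E) \<and>
      Prime (Pred p ls) \<in> set (basis S @ E)"
    by (intro economical_extend_forced[OF assms(1) ground fin c assms(6)])
  then obtain D where D: "economical S (substrings ls) c D" "Prime (Pred p ls) \<in> set D"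
    by blast
  then obtain U where U: "U \<subseteq> instances S (substrings ls)"
    "length D \<le> length (basis S) + c * card U" "rderivation S D"
    unfolding economical_def by blast
  have "c * card U \<le> c * card (instances S (substrings ls))"
    using card_mono[OF fin U(1)] by simp
  with U(2) rderivation_of_prefix[OF U(3) D(2)] show ?thesis
    by (meson add_left_mono le_trans)
qed

section \<open>Counting instances\<close>

lemma finite_card_positive_sum_le:
  assumes "finite V"
  shows "finite {l :: 'v \<Rightarrow> nat. (\<forall>x. x \<in> V \<longleftrightarrow> 0 < l x) \<and> sum l V \<le> N} \<and>
    card {l :: 'v \<Rightarrow> nat. (\<forall>x. x \<in> V \<longleftrightarrow> 0 < l x) \<and> sum l V \<le> N} \<le> N choose card V"
  using assms
proof (induction V arbitrary: N rule: finite_induct)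
  case empty
  have "{l :: 'v \<Rightarrow> nat. (\<forall>x. x \<in> {} \<longleftrightarrow> 0 < l x) \<and> sum l {} \<le> N} = {\<lambda>_. 0}" by auto
  then show ?case by simp
next
  case (insert x V)
  let ?L = "\<lambda>V N. {l :: 'v \<Rightarrow> nat. (\<forall>x. x \<in> V \<longleftrightarrow> 0 < l x) \<and> sum l V \<le> N}"
  let ?T = "SIGMA a:{1..N}. ?L V (N - a)"
  \<comment> \<open>Split off the value \<open>a\<close> at \<open>x\<close>; the remaining values
    then sum to at most \<open>N - a\<close>.\<close>
  let ?f = "\<lambda>l :: 'v \<Rightarrow> nat. (l x, l(x := 0))"
  have inj: "inj_on ?f (?L (insert x V) N)"
  proof (rule inj_onI)
    fix l l' :: "'v \<Rightarrow> nat"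
    assume "?f l = ?f l'"
    then have "l x = l' x" "l(x := 0) = l'(x := 0)" by simp_all
    then show "l = l'" by (metis fun_upd_triv fun_upd_upd)
  qed
  have sub: "?f ` ?L (insert x V) N \<subseteq> ?T"
  proof -
    have "sum (l(x := 0)) V = sum l V" for l :: "'v \<Rightarrow> nat"
      using insert by (intro sum.cong) auto
    then show ?thesis using insert by (auto simp: Suc_le_eq split: if_splits)
  qed
  have fin: "finite ?T" using insert.IH by (intro finite_SigmaI) auto
  have "card ?T = (\<Sum>a=1..N. card (?L V (N - a)))"
    using insert.IH by (intro card_SigmaI) auto
  also have "\<dots> \<le> (\<Sum>a=1..N. (N - a) choose card V)"
    using insert.IH by (intro sum_mono) auto
  \<comment> \<open>The reflection \<open>j = N - a\<close> starts at \<open>a = 1\<close>, hence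
    \<open>j < N\<close>; the hockey-stick identity then evaluates the sum.\<close>
  also have "\<dots> = (\<Sum>j<N. j choose card V)"
    by (rule sum.reindex_bij_witness[of _ "\<lambda>j. N - j" "\<lambda>a. N - a"]) auto
  also have "\<dots> = N choose Suc (card V)"
    by (cases N) (simp_all add: lessThan_Suc_atMost sum_choose_upper)
  finally have "card ?T \<le> N choose card (insert x V)" using insert by simp
  then show ?case
    using card_inj_on_le[OF inj sub fin] inj_on_finite[OF inj sub fin] by linarith
qed

text \<open>Once the lengths are known, the places where the common string is cut are known, and so
  are the pieces.\<close>

lemma sub_inj_lengths:
  "sub \<sigma> m = sub \<tau> m \<Longrightarrow> (\<And>x. x \<in> list_vars m \<Longrightarrow> length (\<sigma> x) = length (\<tau> x)) \<Longrightarrow>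
    x \<in> list_vars m \<Longrightarrow> \<sigma> x = \<tau> x"
  by (induction m rule: string_induct) auto

lemma length_sub_mono:
  "(\<And>x. x \<in> list_vars m \<Longrightarrow> length (\<sigma> x) \<le> length (\<tau> x)) \<Longrightarrow>
    length (sub \<sigma> m) \<le> length (sub \<tau> m)"
  by (induction m rule: string_induct) (auto intro: add_mono)

text \<open>This excludes two solutions of the same equation whose lengths differ at a single
  occurring variable.\<close>

lemma length_sub_strict_mono:
  "(\<And>x. x \<in> list_vars m \<Longrightarrow> length (\<sigma> x) \<le> length (\<tau> x)) \<Longrightarrow>
    y \<in> list_vars m \<Longrightarrow> length (\<sigma> y) < length (\<tau> y) \<Longrightarrow>
    length (sub \<sigma> m) < length (sub \<tau> m)"
proof (induction m rule: string_induct)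
  case (Var x l)
  have le: "length (\<sigma> x) \<le> length (\<tau> x)" using Var.prems by simp
  have le': "length (sub \<sigma> l) \<le> length (sub \<tau> l)" using Var.prems by (intro length_sub_mono) simp
  show ?case
  proof (cases "y = x")
    case True
    then show ?thesis using le' Var.prems by simp
  next
    case False
    then have "length (sub \<sigma> l) < length (sub \<tau> l)" using Var by simp
    then show ?thesis using le by simp
  qed
qed auto

text \<open>Every variable in the sum occurs at least once; repeated occurrences and other symbols
  only lengthen the string.\<close>

lemma sum_length_le_length_sub: "(\<Sum>x\<in>list_vars m. length (\<sigma> x)) \<le> length (sub \<sigma> m)"
proof (induction m rule: string_induct)
  case (Var x l)
  then show ?case by (cases "x \<in> list_vars l") (auto simp: insert_absorb)
qed auto

text \<open>For \<open>j > n\<close> the binomial coefficient vanishes, so the truncation at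
  \<open>min n k\<close> in \<open>Gamma_max\<close> does no harm.\<close>

lemma choose_le_Gamma_max:
  assumes "1 \<le> j" "j \<le> k" "1 \<le> N" "N \<le> n"
  shows "(N - 1) choose (j - 1) \<le> Gamma_max n k"
proof (cases "j \<le> n")
  case True
  have "(N - 1) choose (j - 1) \<le> (n - 1) choose (j - 1)"
    using assms by (intro binomial_right_mono diff_le_mono)
  also have "\<dots> \<le> Gamma_max n k"
    using assms True unfolding Gamma_max_def by (auto intro!: Max_ge)
  finally show ?thesis .
next
  case False
  with assms show ?thesis by (simp add: binomial_eq_0)
qed

text \<open>Emptiness off the variables makes a solution unique as a function. Values need not be
  lists; this can only enlarge the set to be counted.\<close>

definition matchings :: "'a string list \<Rightarrow> 'a string set \<Rightarrow> (nat \<Rightarrow> 'a string) set" where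
  "matchings ms W = {\<sigma>. (\<forall>x. x \<in> \<Union> (list_vars ` set ms) \<longleftrightarrow> \<sigma> x \<noteq> []) \<and> (\<forall>m\<in>set ms. sub \<sigma> m \<in> W)}"

text \<open>A matching is determined by the lengths it assigns to all but one of the variables of \<open>m\<close>,
  since the remaining length follows from \<open>length w\<close>.\<close>

lemma finite_card_matchings_single:
  assumes "card (list_vars m) \<le> k" "1 \<le> k" "w \<noteq> []" "length w \<le> n"
  shows "finite (matchings [m] {w}) \<and> card (matchings [m] {w}) \<le> Gamma_max n k"
proof -
  have len: "1 \<le> length w" using assms(3) by (simp add: Suc_le_eq)
  show ?thesis
  proof (cases "list_vars m = {}")
    case True
    then have sub: "matchings [m] {w} \<subseteq> {\<lambda>_. []}" by (auto simp: matchings_def)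
    then have "card (matchings [m] {w}) \<le> 1" using card_mono[OF _ sub] by simp
    \<comment> \<open>The bound 1 is the term \<open>j = 1\<close> of the maximum, available since
      \<open>n\<close> and \<open>k\<close> are positive.\<close>
    also have "\<dots> \<le> Gamma_max n k"
      using choose_le_Gamma_max[of 1 k 1 n] assms(2,4) len by simp
    finally show ?thesis using finite_subset[OF sub] by simp
  next
    case False
    then obtain x0 where x0: "x0 \<in> list_vars m" by blast
    define V where "V = list_vars m - {x0}"
    \<comment> \<open>The entry at \<open>x0\<close> is erased, so that \<open>h \<sigma>\<close> is
      positive exactly on \<open>V\<close>.\<close>
    define h where "h \<sigma> x = (if x = x0 then 0 else length (\<sigma> x))" for \<sigma> :: "nat \<Rightarrow> 'a string" and x
    let ?L = "{l :: nat \<Rightarrow> nat. (\<forall>x. x \<in> V \<longleftrightarrow> 0 < l x) \<and> sum l V \<le> length w - 1}"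
    have sub: "h ` matchings [m] {w} \<subseteq> ?L"
    proof
      fix l assume "l \<in> h ` matchings [m] {w}"
      then obtain \<sigma> where \<sigma>: "l = h \<sigma>" "\<And>x. x \<in> list_vars m \<longleftrightarrow> \<sigma> x \<noteq> []" "sub \<sigma> m = w"
        by (auto simp: matchings_def)
      have "sum (h \<sigma>) V = (\<Sum>x\<in>V. length (\<sigma> x))"
        by (intro sum.cong) (auto simp: h_def V_def)
      moreover have "(\<Sum>x\<in>list_vars m. length (\<sigma> x)) = length (\<sigma> x0) + (\<Sum>x\<in>V. length (\<sigma> x))"
        unfolding V_def using x0 by (simp add: sum.remove)
      \<comment> \<open>The omitted variable takes up at least one symbol, whence the bound
        \<open>length w - 1\<close> on the other lengths.\<close>
      moreover have "length (\<sigma> x0) \<ge> 1" using \<sigma>(2) x0 by (simp add: Suc_le_eq)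
      ultimately have "sum (h \<sigma>) V \<le> length w - 1"
        using sum_length_le_length_sub[of \<sigma> m] \<sigma>(3) by simp
      moreover have "\<forall>x. x \<in> V \<longleftrightarrow> 0 < h \<sigma> x" using \<sigma>(2) by (auto simp: h_def V_def)
      ultimately show "l \<in> ?L" using \<sigma>(1) by simp
    qed
    have inj: "inj_on h (matchings [m] {w})"
    proof (rule inj_onI)
      fix \<sigma> \<tau> assume \<sigma>: "\<sigma> \<in> matchings [m] {w}" and \<tau>: "\<tau> \<in> matchings [m] {w}" and eq: "h \<sigma> = h \<tau>"
      have len_eq: "length (\<sigma> x) = length (\<tau> x)" if "x \<noteq> x0" for x
        using fun_cong[OF eq, of x] that by (simp add: h_def)
      have sub_eq: "sub \<sigma> m = sub \<tau> m" using \<sigma> \<tau> by (simp add: matchings_def)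
      \<comment> \<open>Stated for arbitrary assignments so as to apply in both directions.\<close>
      have not_less: "\<not> length (\<sigma>' x0) < length (\<tau>' x0)"
        if "sub \<sigma>' m = sub \<tau>' m" "\<And>x. x \<noteq> x0 \<Longrightarrow> length (\<sigma>' x) = length (\<tau>' x)"
        for \<sigma>' \<tau>' :: "nat \<Rightarrow> 'a string"
      proof
        assume less: "length (\<sigma>' x0) < length (\<tau>' x0)"
        have "length (\<sigma>' x) \<le> length (\<tau>' x)" for x
          using that(2)[of x] less by (cases "x = x0") auto
        then have "length (sub \<sigma>' m) < length (sub \<tau>' m)"
          using length_sub_strict_mono[of m \<sigma>' \<tau>' x0] x0 less by blast
        with that(1) show False by simp
      qed
      have "length (\<sigma> x0) = length (\<tau> x0)"
        using not_less[OF sub_eq len_eq] not_less[OF sub_eq[symmetric] len_eq[symmetric]] by simp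
      with len_eq have len_all: "length (\<sigma> x) = length (\<tau> x)" for x by (cases "x = x0") auto
      show "\<sigma> = \<tau>"
      proof
        fix x
        show "\<sigma> x = \<tau> x"
        proof (cases "x \<in> list_vars m")
          case True
          then show ?thesis using sub_inj_lengths[OF sub_eq len_all] by blast
        next
          case False
          then show ?thesis using \<sigma> \<tau> by (simp add: matchings_def)
        qed
      qed
    qed
    have "finite V" by (simp add: V_def)
    note L = finite_card_positive_sum_le[OF this, of "length w - 1"]
    have card_V: "card V = card (list_vars m) - 1" using x0 by (simp add: V_def)
    have "1 \<le> card (list_vars m)" using x0 by (auto simp: Suc_le_eq card_gt_0_iff)
    then have "(length w - 1) choose card V \<le> Gamma_max n k"
      unfolding card_V using assms(1,4) len by (intro choose_le_Gamma_max) auto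
    then show ?thesis
      using card_inj_on_le[OF inj sub conjunct1[OF L]] conjunct2[OF L]
        inj_on_finite[OF inj sub conjunct1[OF L]] by linarith
  qed
qed

lemma finite_card_matchings_one:
  assumes "card (list_vars m) \<le> k" "1 \<le> k" "finite W" "\<And>w. w \<in> W \<Longrightarrow> w \<noteq> [] \<and> length w \<le> n"
  shows "finite (matchings [m] W) \<and> card (matchings [m] W) \<le> card W * Gamma_max n k"
proof -
  have eq: "matchings [m] W = (\<Union>w\<in>W. matchings [m] {w})" by (auto simp: matchings_def)
  have single: "finite (matchings [m] {w}) \<and> card (matchings [m] {w}) \<le> Gamma_max n k" if "w \<in> W" for w
    using finite_card_matchings_single[OF assms(1,2)] assms(4)[OF that] by blast
  have "card (\<Union>w\<in>W. matchings [m] {w}) \<le> (\<Sum>w\<in>W. card (matchings [m] {w}))"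
    by (rule card_UN_le[OF assms(3)])
  also have "\<dots> \<le> (\<Sum>w\<in>W. Gamma_max n k)" using single by (intro sum_mono) blast
  finally show ?thesis unfolding eq using assms(3) single by simp
qed

text \<open>A matching is determined by its restrictions to the variables of \<open>m\<close> and to
  those of \<open>ms\<close>, even if these overlap, so the counts multiply.\<close>

lemma finite_card_matchings:
  assumes "\<And>m. m \<in> set ms \<Longrightarrow> finite (matchings [m] W) \<and> card (matchings [m] W) \<le> B"
  shows "finite (matchings ms W) \<and> card (matchings ms W) \<le> B ^ length ms"
  using assms
proof (induction ms)
  case Nil
  have "matchings [] W = {\<lambda>_. []}" by (auto simp: matchings_def)
  then show ?case by simp
next
  case (Cons m ms)
  define restr where "restr V \<sigma> x = (if x \<in> V then \<sigma> x else [])"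
    for V and \<sigma> :: "nat \<Rightarrow> 'a string" and x
  let ?U = "\<Union> (list_vars ` set ms)"
  let ?f = "\<lambda>\<sigma>. (restr (list_vars m) \<sigma>, restr ?U \<sigma>)"
  have inj: "inj_on ?f (matchings (m # ms) W)"
  proof (rule inj_onI)
    fix \<sigma> \<tau> assume \<sigma>: "\<sigma> \<in> matchings (m # ms) W" and \<tau>: "\<tau> \<in> matchings (m # ms) W" and eq: "?f \<sigma> = ?f \<tau>"
    show "\<sigma> = \<tau>"
    proof
      fix x
      have "restr (list_vars m) \<sigma> x = restr (list_vars m) \<tau> x" "restr ?U \<sigma> x = restr ?U \<tau> x"
        using eq by simp_all
      moreover have "\<sigma> x = []" "\<tau> x = []" if "x \<notin> list_vars m" "x \<notin> ?U"
        using \<sigma> \<tau> that by (auto simp: matchings_def)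
      ultimately show "\<sigma> x = \<tau> x"
        by (cases "x \<in> list_vars m"; cases "x \<in> ?U") (simp_all add: restr_def)
    qed
  qed
  have sub: "?f ` matchings (m # ms) W \<subseteq> matchings [m] W \<times> matchings ms W"
  proof -
    have "sub (restr (list_vars m) \<sigma>) m = sub \<sigma> m" for \<sigma>
      by (rule sub_cong) (simp add: restr_def)
    moreover have "sub (restr ?U \<sigma>) m' = sub \<sigma> m'" if "m' \<in> set ms" for \<sigma> m'
      using that by (intro sub_cong) (auto simp: restr_def)
    ultimately show ?thesis by (auto simp: matchings_def restr_def[of _ _ x for x] split: if_splits)
  qed
  have m: "finite (matchings [m] W)" "card (matchings [m] W) \<le> B" using Cons.prems by auto
  have ms: "finite (matchings ms W)" "card (matchings ms W) \<le> B ^ length ms" using Cons by auto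
  have "card (matchings (m # ms) W) \<le> card (matchings [m] W \<times> matchings ms W)"
    using inj sub m ms by (intro card_inj_on_le) auto
  also have "\<dots> \<le> B * B ^ length ms"
    unfolding card_cartesian_product using m ms by (intro mult_mono) auto
  finally show ?case using inj_on_finite[OF inj sub] m ms by simp
qed

text \<open>Lists are nonempty and all variables of \<open>F\<close> occur in its conclusion, so an
  instance is an axiom together with a matching of its conclusion arguments.\<close>

lemma instances_subset:
  assumes "special_recursive S"
  shows "instances S W \<subseteq> (SIGMA F:set (basis S). matchings (args (rconclusion F)) W)"
proof
  fix i assume "i \<in> instances S W"
  then obtain F \<sigma> where i: "i = (F, \<sigma>)" "(F, \<sigma>) \<in> instances S W" by (cases i) auto
  then have F: "F \<in> set (basis S)" by (simp add: instances_def)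
  have "\<sigma> x \<noteq> []" if "x \<in> formula_vars F" for x
    using i that is_list_not_Nil[of "op_syms S" "\<sigma> x"] by (auto simp: instances_def)
  with i F show "i \<in> (SIGMA F:set (basis S). matchings (args (rconclusion F)) W)"
    using formula_vars_conclusion[OF assms F]
    by (auto simp: instances_def matchings_def prime_vars_def)
qed

lemma finite_card_instances:
  assumes "special_recursive S"
    and "\<And>F. F \<in> set (basis S) \<Longrightarrow>
      finite (matchings (args (rconclusion F)) W) \<and> card (matchings (args (rconclusion F)) W) \<le> M"
  shows "finite (instances S W) \<and> card (instances S W) \<le> length (basis S) * M"
proof -
  let ?T = "SIGMA F:set (basis S). matchings (args (rconclusion F)) W"
  have fin: "finite ?T" using assms(2) by (intro finite_SigmaI) auto
  have "card (instances S W) \<le> card ?T"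
    using fin instances_subset[OF assms(1)] by (rule card_mono)
  also have "\<dots> = (\<Sum>F\<in>set (basis S). card (matchings (args (rconclusion F)) W))"
    using assms(2) by (intro card_SigmaI) auto
  also have "\<dots> \<le> (\<Sum>F\<in>set (basis S). M)" using assms(2) by (intro sum_mono) blast
  also have "\<dots> \<le> length (basis S) * M" by (simp add: card_length)
  finally show ?thesis using finite_subset[OF instances_subset[OF assms(1)] fin] by simp
qed

section \<open>Number of nonempty substrings\<close>

lemma finite_card_substrings:
  assumes "\<And>l. l \<in> set ls \<Longrightarrow> length l \<le> n"
  shows "finite (substrings ls) \<and> card (substrings ls) \<le> length ls * (n * (n + 1) div 2)"
proof -
  have eq: "substrings ls = (\<Union>l\<in>set ls. set (sublists l) - {[]})"
    by (auto simp: substrings_def)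
  have "card (substrings ls) \<le> (\<Sum>l\<in>set ls. card (set (sublists l) - {[]}))"
    unfolding eq by (rule card_UN_le) simp
  also have "\<dots> \<le> (\<Sum>l\<in>set ls. n * (n + 1) div 2)"
  proof (rule sum_mono)
    fix l assume "l \<in> set ls"
    \<comment> \<open>The enumeration \<open>sublists l\<close> has one entry more than the
      triangular number; the removal of \<open>[]\<close> accounts for it.\<close>
    have "card (set (sublists l) - {[]}) = card (set (sublists l)) - 1" by (simp add: card_Diff_singleton)
    also have "\<dots> \<le> length l * Suc (length l) div 2"
      using card_length[of "sublists l"] by simp
    also have "\<dots> \<le> n * (n + 1) div 2"
      using assms[OF \<open>l \<in> set ls\<close>] by (intro div_le_mono mult_mono) auto
    finally show "card (set (sublists l) - {[]}) \<le> n * (n + 1) div 2" .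
  qed
  also have "\<dots> \<le> length ls * (n * (n + 1) div 2)" using card_length[of ls] by simp
  finally show ?thesis unfolding eq by simp
qed

section \<open>The maxima of the system as bounds for single axioms\<close>

lemma card_list_vars_le_max_vars:
  assumes "F \<in> set (basis S)" "P \<in> set (primes_of F)" "l \<in> set (args P)"
  shows "card (list_vars l) \<le> max_vars S"
proof -
  \<comment> \<open>Written as a union over finite sets, the comprehension is visibly finite, as
    \<open>Max_ge\<close> requires.\<close>
  have "{card (list_vars l) | F P l. F \<in> set (basis S) \<and> P \<in> set (primes_of F) \<and> l \<in> set (args P)} =
    (\<Union>F\<in>set (basis S). \<Union>P\<in>set (primes_of F). (\<lambda>l. card (list_vars l)) ` set (args P))"
    by blast
  then show ?thesis unfolding max_vars_def using assms by (intro Max_ge) auto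
qed

lemma length_args_le_max_args:
  assumes "F \<in> set (basis S)" "P \<in> set (primes_of F)"
  shows "length (args P) \<le> max_args S"
proof -
  have "{length (args P) | F P. F \<in> set (basis S) \<and> P \<in> set (primes_of F)} =
    (\<Union>F\<in>set (basis S). (\<lambda>P. length (args P)) ` set (primes_of F))"
    by blast
  then show ?thesis unfolding max_args_def using assms by (intro Max_ge) auto
qed

lemma length_primes_of_le_max_primes:
  assumes "F \<in> set (basis S)"
  shows "length (primes_of F) \<le> max_primes S"
proof -
  have "{length (primes_of F) | F. F \<in> set (basis S)} = (\<lambda>F. length (primes_of F)) ` set (basis S)"
    by blast
  then show ?thesis unfolding max_primes_def using assms by (intro Max_ge) auto
qed

text \<open>It suffices to count in the conclusion, so the number of premises does not
  enter.\<close>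

lemma card_formula_vars_le:
  assumes "special_recursive S" "F \<in> set (basis S)"
  shows "card (formula_vars F) \<le> max_args S * max_vars S"
proof -
  have concl: "rconclusion F \<in> set (primes_of F)" by (simp add: primes_of_def)
  have "card (formula_vars F) \<le> (\<Sum>l\<in>set (args (rconclusion F)). card (list_vars l))"
    unfolding formula_vars_conclusion[OF assms] prime_vars_def by (rule card_UN_le) simp
  also have "\<dots> \<le> (\<Sum>l\<in>set (args (rconclusion F)). max_vars S)"
    by (intro sum_mono card_list_vars_le_max_vars[OF assms(2) concl])
  also have "\<dots> \<le> max_args S * max_vars S"
    using card_length[of "args (rconclusion F)"] length_args_le_max_args[OF assms(2) concl] by simp
  finally show ?thesis .
qed

section \<open>The step bound from the number of instances and their cost\<close>

theorem mainTheorem6: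
  fixes S :: "('a, 'p) rsystem" and p :: 'p and ls :: "'a string list"
    and n k \<alpha> \<rho> :: nat
  assumes "special_recursive S"
    and "is_prime_formula S (Pred p ls)"
    and "elementary (Pred p ls :: ('a, 'p) prime_formula)"
    and "rderivable S (Prime (Pred p ls))"
    and "n = max_length ls"
    and "k = max_vars S"
    and "\<alpha> = max_args S"
    and "\<rho> = max_primes S"
  shows "\<exists>D. rderivation_of S D (Prime (Pred p ls)) \<and>
    real (length D) \<le> real (length (basis S)) * real \<rho> *
      (1 + real \<alpha> * real k * (real \<alpha> * (real n * (real n + 1) / 2) * real (Gamma_max n k)) ^ \<alpha>)"
proof -
  let ?B = "length (basis S)"
  let ?I = "instances S (substrings ls)"
  let ?M = "(real \<alpha> * (real n * (real n + 1) / 2) * real (Gamma_max n k)) ^ \<alpha>"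
  have ground: "\<And>l. l \<in> set ls \<Longrightarrow> list_vars l = {}" using assms(3) by (simp add: elementary_def)
  have ne: "[] \<notin> set ls" using assms(2) by (auto dest: is_list_not_Nil)
  have len: "length l \<le> n" if "l \<in> set ls" for l
    unfolding assms(5) max_length_def using that by (intro Max_ge) auto
  have forced: "forced S (Pred p ls)" using rderivable_Pred_forced[OF assms(1,4)] .
  \<comment> \<open>The last generation step of the target supplies a basis axiom, which yields
    \<open>length ls \<le> \<alpha>\<close> and \<open>1 \<le> \<rho>\<close>.\<close>
  then obtain F0 \<sigma>0 where F0: "F0 \<in> set (basis S)" "Pred p ls = psub \<sigma>0 (rconclusion F0)"
    by (cases rule: forced.cases) auto
  have "length ls = length (args (psub \<sigma>0 (rconclusion F0)))" by (simp flip: F0(2))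
  also have "\<dots> \<le> \<alpha>"
    using length_args_le_max_args[OF F0(1), of "rconclusion F0"] by (simp add: primes_of_def assms(7))
  finally have length_ls: "length ls \<le> \<alpha>" .
  have prem: "length (rpremises F) \<le> \<rho> - 1" if "F \<in> set (basis S)" for F
    using length_primes_of_le_max_primes[OF that] by (simp add: primes_of_def assms(8))
  have \<rho>: "1 \<le> \<rho>"
    using length_primes_of_le_max_primes[OF F0(1)] by (simp add: primes_of_def assms(8))
  have args: "length (args (rconclusion F)) \<le> \<alpha>" if "F \<in> set (basis S)" for F
    using length_args_le_max_args[OF that] by (simp add: primes_of_def assms(7))
  have vars: "card (list_vars m) \<le> k" if "F \<in> set (basis S)" "m \<in> set (args (rconclusion F))" for F m
    using card_list_vars_le_max_vars[OF that(1) _ that(2)] by (simp add: primes_of_def assms(6))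
  have W: "finite (substrings ls)" "card (substrings ls) \<le> length ls * (n * (n + 1) div 2)"
    using finite_card_substrings[OF len] by auto
  have W_len: "w \<noteq> [] \<and> length w \<le> n" if "w \<in> substrings ls" for w
    using that len sublist_length_le le_trans unfolding substrings_def by blast
  show ?thesis
  \<comment> \<open>In the degenerate case the claimed bound shrinks to \<open>?B * \<rho>\<close>,
    so no substitution may be charged. Indeed a conclusion argument of an instance forces
    \<open>n\<close> and \<open>\<alpha>\<close> to be positive, hence \<open>k = 0\<close>:
    instances have no variables, and each axiom has at most one.\<close>
  proof (cases "n = 0 \<or> \<alpha> * k = 0")
    case True
    have no_vars: "list_vars m = {}"
      if "(F, \<sigma>) \<in> ?I" "m \<in> set (args (rconclusion F))" for F \<sigma> m
    proof -
      have F: "F \<in> set (basis S)" and "sub \<sigma> m \<in> substrings ls"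
        using that by (auto simp: instances_def)
      with W_len[of "sub \<sigma> m"] have "n \<noteq> 0" by (cases n) auto
      moreover have "\<alpha> \<noteq> 0" using args[OF F] that(2) by (cases \<alpha>) auto
      ultimately have "k = 0" using True by simp
      with vars[OF F that(2)] show ?thesis by simp
    qed
    have formula_vars: "formula_vars F = {}" if "(F, \<sigma>) \<in> ?I" for F \<sigma>
      using that no_vars formula_vars_conclusion[OF assms(1), of F]
      by (auto simp: instances_def prime_vars_def)
    have sub: "?I \<subseteq> set (basis S) \<times> {\<lambda>_. []}"
    proof
      fix i assume "i \<in> ?I"
      then obtain F \<sigma> where i: "i = (F, \<sigma>)" "(F, \<sigma>) \<in> ?I" by (cases i) auto
      with formula_vars[OF i(2)] show "i \<in> set (basis S) \<times> {\<lambda>_. []}"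
        by (simp add: instances_def fun_eq_iff)
    qed
    have fin: "finite ?I" using finite_subset[OF sub] by simp
    have "card ?I \<le> card (set (basis S) \<times> {\<lambda>_ :: nat. [] :: 'a string})" by (rule card_mono[OF _ sub]) simp
    also have "\<dots> \<le> ?B" by (simp add: card_cartesian_product card_length)
    finally have card: "card ?I \<le> ?B" .
    have "card (formula_vars F) + length (rpremises F) \<le> \<rho> - 1" if "(F, \<sigma>) \<in> ?I" for F \<sigma>
      using formula_vars[OF that] prem that by (auto simp: instances_def)
    then have "\<exists>D. rderivation_of S D (Prime (Pred p ls)) \<and> length D \<le> ?B + (\<rho> - 1) * card ?I"
      by (intro derivation_bound_instances[OF assms(1) ground ne fin _ forced])
    then obtain D where
      D: "rderivation_of S D (Prime (Pred p ls))" "length D \<le> ?B + (\<rho> - 1) * card ?I" by blast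
    have "?B + (\<rho> - 1) * card ?I \<le> ?B + (\<rho> - 1) * ?B" using card by simp
    also have "\<dots> = ?B * \<rho>" using \<rho> by (cases \<rho>) auto
    finally have "real (length D) \<le> real (?B * \<rho>)" using D(2) by linarith
    also have "\<dots> = real ?B * real \<rho> * 1" by simp
    also have "\<dots> \<le> real ?B * real \<rho> * (1 + real \<alpha> * real k * ?M)"
      by (intro mult_left_mono) auto
    finally show ?thesis using D(1) by blast
  next
    case False
    then have pos: "1 \<le> n" "1 \<le> \<alpha>" "1 \<le> k" "1 \<le> \<alpha> * k" by auto
    \<comment> \<open>The base of the power in natural numbers. Being at least 1, it allows raising
      the exponent to \<open>\<alpha>\<close> for axioms with fewer conclusion arguments.\<close>
    define N where "N = \<alpha> * (n * (n + 1) div 2) * Gamma_max n k"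
    have "1 \<le> Gamma_max n k" using choose_le_Gamma_max[of 1 k 1 n] pos by simp
    moreover have "1 \<le> n * (n + 1) div 2"
      using pos div_le_mono[of 2 "n * (n + 1)" 2] mult_le_mono[of 1 n 2 "n + 1"] by simp
    ultimately have N: "1 \<le> N" using pos unfolding N_def by (simp add: Suc_le_eq)
    have "card (substrings ls) * Gamma_max n k \<le> N"
      unfolding N_def by (intro mult_le_mono1 le_trans[OF W(2)] length_ls)
    then have one: "finite (matchings [m] (substrings ls)) \<and> card (matchings [m] (substrings ls)) \<le> N"
      if "F \<in> set (basis S)" "m \<in> set (args (rconclusion F))" for F m
      using finite_card_matchings_one[OF vars[OF that] pos(3) W(1) W_len] by (meson le_trans)
    have "finite (matchings (args (rconclusion F)) (substrings ls)) \<and>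
        card (matchings (args (rconclusion F)) (substrings ls)) \<le> N ^ \<alpha>"
      if F: "F \<in> set (basis S)" for F
      using finite_card_matchings[OF one[OF F]] power_increasing[OF args[OF F] N] by (meson le_trans)
    from finite_card_instances[OF assms(1) this]
    have fin: "finite ?I" and card: "card ?I \<le> ?B * N ^ \<alpha>" by auto
    have "card (formula_vars F) + length (rpremises F) \<le> \<alpha> * k + (\<rho> - 1)" if "(F, \<sigma>) \<in> ?I" for F \<sigma>
    proof -
      have F: "F \<in> set (basis S)" using that by (simp add: instances_def)
      show ?thesis
        unfolding assms(6,7) using card_formula_vars_le[OF assms(1) F] prem[OF F] by (rule add_mono)
    qed
    then have "\<exists>D. rderivation_of S D (Prime (Pred p ls)) \<and> length D \<le> ?B + (\<alpha> * k + (\<rho> - 1)) * card ?I"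
      by (intro derivation_bound_instances[OF assms(1) ground ne fin _ forced])
    then obtain D where
      D: "rderivation_of S D (Prime (Pred p ls))" "length D \<le> ?B + (\<alpha> * k + (\<rho> - 1)) * card ?I" by blast
    obtain r where r: "\<rho> = Suc r" using \<rho> by (cases \<rho>) auto
    obtain q where q: "\<alpha> * k = Suc q" using pos(4) by (cases "\<alpha> * k") auto
    \<comment> \<open>The two sides differ by \<open>r * q\<close>.\<close>
    have "\<alpha> * k + (\<rho> - 1) \<le> \<rho> * (\<alpha> * k)" unfolding r q by simp
    then have "?B + (\<alpha> * k + (\<rho> - 1)) * card ?I \<le> ?B * \<rho> + \<rho> * (\<alpha> * k) * (?B * N ^ \<alpha>)"
      using card \<rho> by (intro add_mono mult_mono) auto
    also have "\<dots> = ?B * \<rho> * (1 + \<alpha> * k * N ^ \<alpha>)" by (simp add: algebra_simps)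
    finally have "real (length D) \<le> real (?B * \<rho> * (1 + \<alpha> * k * N ^ \<alpha>))"
      using D(2) by linarith
    also have "\<dots> = real ?B * real \<rho> * (1 + real \<alpha> * real k * real N ^ \<alpha>)" by (simp add: algebra_simps)
    also have "\<dots> \<le> real ?B * real \<rho> * (1 + real \<alpha> * real k * ?M)"
    proof -
      have "real (n * (n + 1) div 2) \<le> real n * (real n + 1) / 2"
        using of_nat_div_le_of_nat[of "n * (n + 1)" 2, where 'a = real] by (simp add: algebra_simps)
      then have "real N \<le> real \<alpha> * (real n * (real n + 1) / 2) * real (Gamma_max n k)"
        unfolding N_def of_nat_mult by (intro mult_mono) auto
      then show ?thesis by (intro mult_left_mono add_left_mono power_mono) auto
    qed
    finally show ?thesis using D(1) by blast
  qed
qed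

end
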